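(* Let $G=(V,E)$ be a simple graph, let $F$ be a field of characteristic $0$ or $F=\mathbb{Z}_p$ with $p$ prime, and let $(L,C)$ be an $F$-correspondence assignment on $G$. Let $G^s$ be the multigraph formed by replacing each edge $e\in E(G)$ with $\omega^s(e)$ parallel edges $e_1,\dots,e_{\omega^s(e)}$, and let $(L,C^s)$ be the signable $F$-correspondence assignment on $G^s$ given by fixed signable partial matchings $C^s_{e_1},\dots,C^s_{e_{\omega^s(e)}}$ with $C_e=\bigcup_{i=1}^{\omega^s(e)}C^s_{e_i}$ for each $e\in E(G)$; let $\sigma:E(G^s)\to\{1,-1\}$ be a sign function for $(L,C^s)$. If there exists an orientation $D$ of $G^s$ such that $EE(D_\sigma)-EO(D_\sigma)\not\equiv 0_F$ and $|L(v)|\ge d^+_D(v)+1$ for each $v\in V(G)$, then $G$ is $(L,C)$-colorable.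
   Context: Graphs. Multigraphs and digraphs are finite and loopless; parallel edges are allowed and are regarded as distinct; a graph is simple if it has no parallel edges. Write $e=\{v,w\}$ if $v,w$ are the endpoints of the edge $e$, and $\vec e=(v,w)$ if $\vec e$ is a directed edge from $v$ to $w$. An orientation $D$ of a multigraph $G$ is a digraph on vertex set $V(G)$ obtained by choosing one direction for each edge; $\vec e$ is the directed edge of $D$ corresponding to $e$. $d^+_D(v)$ and $d^-_D(v)$ are the out-degree and in-degree of $v$ in $D$. Eulerian subdigraphs. A digraph $H$ is Eulerian if $d^+_H(v)=d^-_H(v)$ for every vertex $v$ (connectedness is not required). A digraph is even (odd) if it has an even (odd) number of edges. $EE(H)$ and $EO(H)$ denote the numbers of even, respectively odd, spanning Eulerian subdigraphs of $H$ (spanning means having vertex set $V(H)$; the subdigraph with no edges counts). Correspondence assignments. A correspondence assignment $(L,C)$ for a multigraph $G$ consists of lists $L=\{L(v)\}_{v\in V(G)}$ and a function $C$ assigning to every edge $e=\{u,v\}$ a partial matching $C_e$ between $\{u\}\times L(u)$ and $\{v\}\times L(v)$. An $(L,C)$-coloring is a function $f$ with $f(v)\in L(v)$ for all $v$ such that for every edge $e=\{u,v\}$ the pair $\{(u,f(u)),(v,f(v))\}$ is not in $C_e$; $G$ is $(L,C)$-colorable if one exists. For a field $F$, $(L,C)$ is an $F$-correspondence assignment if $L(v)\subseteq F$ for all $v$. Signable. A partial matching $M$ between $\{v\}\times L(v)$ and $\{w\}\times L(w)$ is signable if there exist $s\in\{1,-1\}$ and $a\in F$ such that $c_1-s\,c_2=a$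 for all $\{(v,c_1),(w,c_2)\}\in M$ (this does not depend on the order of $v,w$, and neither does the admissible $s$). For $e\in E(G)$, $\omega^s(e)$ is the least $k$ such that $C_e$ is a union of $k$ partial matchings each of which is signable. (As all multigraphs are finite, the numbers $\omega^s(e)$ are finite.) A sign function for $(L,C^s)$ is a function $\sigma:E(G^s)\to\{1,-1\}$ such that for each edge $e=\{v,w\}$ of $G^s$, with a fixed direction $\vec e=(v,w)$, there is $a_{\vec e}\in F$ with $c_1-\sigma(e)c_2=a_{\vec e}$ whenever $\{(v,c_1),(w,c_2)\}\in C^s_e$. Auxiliary digraph. $D_\sigma$ is the digraph obtained from $D$ by replacing each edge $\vec e=(v,w)\in\vec E(D)$ with $\sigma(e)=-1$ by a directed path of length two from $v$ to $w$ (through a new vertex). For $n\in\mathbb{Z}$, $n\equiv 0_F$ means $n=0$ if $F$ has characteristic $0$, and $n\equiv 0\pmod p$ if $F=\mathbb{Z}_p$. *)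

theory Defs
  imports "HOL-Number_Theory.Cong" "Graph_Theory.Digraph_Component"
begin

section \<open>Multigraphs and orientations\<close>

text \<open>Edges are abstract objects with a set of two endpoints, so parallel edges are distinct.\<close>

record ('v, 'e) multigraph =
  mverts :: "'v set"
  medges :: "'e set"
  mends :: "'e \<Rightarrow> 'v set"

definition is_multigraph :: "('v, 'e) multigraph \<Rightarrow> bool" where
  "is_multigraph G \<longleftrightarrow> finite (mverts G) \<and> finite (medges G) \<and>
     (\<forall>e\<in>medges G. mends G e \<subseteq> mverts G \<and> card (mends G e) = 2)"

definition simple_graph :: "('v, 'e) multigraph \<Rightarrow> bool" where
  "simple_graph G \<longleftrightarrow> is_multigraph G \<and> inj_on (mends G) (medges G)"

definition is_orientation :: "('v, 'e) pre_digraph \<Rightarrow> ('v, 'e) multigraph \<Rightarrow> bool" where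
  "is_orientation D G \<longleftrightarrow> verts D = mverts G \<and> arcs D = medges G \<and>
     (\<forall>e\<in>medges G. mends G e = {tail D e, head D e})"

section \<open>Eulerian subdigraphs\<close>

definition eulerian_digraph :: "('v, 'e) pre_digraph \<Rightarrow> bool" where
  "eulerian_digraph H \<longleftrightarrow> (\<forall>v\<in>verts H. out_degree H v = in_degree H v)"

text \<open>
  A digraph \<open>H\<close> with \<open>spanning H D\<close> has the same vertices and the same (total) functions
  \<open>tail\<close> and \<open>head\<close> as \<open>D\<close>, so it is determined by its set of arcs and is counted once.
\<close>

definition EE :: "('v, 'e) pre_digraph \<Rightarrow> nat" where
  "EE D = card {H. spanning H D \<and> eulerian_digraph H \<and> even (card (arcs H))}"

definition EO :: "('v, 'e) pre_digraph \<Rightarrow> nat" where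
  "EO D = card {H. spanning H D \<and> eulerian_digraph H \<and> odd (card (arcs H))}"

section \<open>The auxiliary digraph\<close>

text \<open>
  An arc \<open>e\<close> with sign \<open>-1\<close> becomes the path consisting of the arcs \<open>Inl e\<close> and \<open>Inr e\<close> through
  the new vertex \<open>Inr e\<close>; any other arc \<open>e\<close> is kept as \<open>Inl e\<close>.
\<close>

definition aux_digraph ::
    "('v, 'e) pre_digraph \<Rightarrow> ('e \<Rightarrow> int) \<Rightarrow> ('v + 'e, 'e + 'e) pre_digraph" where
  "aux_digraph D \<sigma> =
     \<lparr> verts = Inl ` verts D \<union> Inr ` {e \<in> arcs D. \<sigma> e = -1},
       arcs = Inl ` arcs D \<union> Inr ` {e \<in> arcs D. \<sigma> e = -1},
       tail = case_sum (\<lambda>e. Inl (tail D e)) (\<lambda>e. Inr e),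
       head = case_sum (\<lambda>e. if \<sigma> e = -1 then Inr e else Inl (head D e)) (\<lambda>e. Inl (head D e)) \<rparr>"

lemma wf_aux_digraph: "wf_digraph D \<Longrightarrow> wf_digraph (aux_digraph D \<sigma>)"
  by (auto simp: wf_digraph_def aux_digraph_def)

section \<open>Correspondence assignments\<close>

definition partial_matching :: "'a set \<Rightarrow> 'a set \<Rightarrow> 'a set set \<Rightarrow> bool" where
  "partial_matching A B M \<longleftrightarrow>
     (\<forall>m\<in>M. \<exists>a\<in>A. \<exists>b\<in>B. m = {a, b}) \<and> pairwise disjnt M"

lemma partial_matching_sym: "partial_matching A B M \<longleftrightarrow> partial_matching B A M"
  unfolding partial_matching_def by (metis insert_commute)

definition correspondence_assignment ::
    "('v, 'e) multigraph \<Rightarrow> ('v \<Rightarrow> 'f set) \<Rightarrow> ('e \<Rightarrow> ('v \<times> 'f) set set) \<Rightarrow> bool" where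
  "correspondence_assignment G L C \<longleftrightarrow>
     (\<forall>e\<in>medges G. \<forall>u v. mends G e = {u, v} \<longrightarrow>
        partial_matching ({u} \<times> L u) ({v} \<times> L v) (C e))"

definition LC_coloring ::
    "('v, 'e) multigraph \<Rightarrow> ('v \<Rightarrow> 'f set) \<Rightarrow> ('e \<Rightarrow> ('v \<times> 'f) set set) \<Rightarrow> ('v \<Rightarrow> 'f) \<Rightarrow> bool" where
  "LC_coloring G L C f \<longleftrightarrow>
     (\<forall>v\<in>mverts G. f v \<in> L v) \<and>
     (\<forall>e\<in>medges G. \<forall>u v. mends G e = {u, v} \<longrightarrow> {(u, f u), (v, f v)} \<notin> C e)"

definition LC_colorable ::
    "('v, 'e) multigraph \<Rightarrow> ('v \<Rightarrow> 'f set) \<Rightarrow> ('e \<Rightarrow> ('v \<times> 'f) set set) \<Rightarrow> bool" where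
  "LC_colorable G L C \<longleftrightarrow> (\<exists>f. LC_coloring G L C f)"

section \<open>Signs\<close>

text \<open>
  Signs are integers rather than field elements, so that \<open>1\<close> and \<open>-1\<close> remain distinct in
  characteristic two.
\<close>

definition admissible_sign :: "'v \<Rightarrow> 'v \<Rightarrow> ('v \<times> 'f::field) set set \<Rightarrow> int \<Rightarrow> bool" where
  "admissible_sign v w M s \<longleftrightarrow>
     s \<in> {1, -1} \<and> (\<exists>a. \<forall>c1 c2. {(v, c1), (w, c2)} \<in> M \<longrightarrow> c1 - of_int s * c2 = a)"

lemma admissible_sign_sym: "admissible_sign v w M s \<longleftrightarrow> admissible_sign w v M s"
proof -
  have "admissible_sign w v M s" if "admissible_sign v w M s" for v w
  proof -
    from that obtain a where s: "s \<in> {1, -1}"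
      and a: "\<And>c1 c2. {(v, c1), (w, c2)} \<in> M \<Longrightarrow> c1 - of_int s * c2 = a"
      by (auto simp: admissible_sign_def)
    have "c1 - of_int s * c2 = - of_int s * a" if "{(w, c1), (v, c2)} \<in> M" for c1 c2
      using a[of c2 c1] that s by (auto simp: insert_commute algebra_simps)
    with s show ?thesis by (auto simp: admissible_sign_def)
  qed
  then show ?thesis by blast
qed

definition signable :: "'v \<Rightarrow> 'v \<Rightarrow> ('v \<times> 'f::field) set set \<Rightarrow> bool" where
  "signable v w M \<longleftrightarrow> (\<exists>s. admissible_sign v w M s)"

definition signable_matching_on ::
    "('v, 'e) multigraph \<Rightarrow> ('v \<Rightarrow> 'f::field set) \<Rightarrow> 'e \<Rightarrow> ('v \<times> 'f) set set \<Rightarrow> bool" where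
  "signable_matching_on G L e M \<longleftrightarrow>
     (\<forall>v w. mends G e = {v, w} \<longrightarrow>
        partial_matching ({v} \<times> L v) ({w} \<times> L w) M \<and> signable v w M)"

definition signable_assignment ::
    "('v, 'e) multigraph \<Rightarrow> ('v \<Rightarrow> 'f::field set) \<Rightarrow> ('e \<Rightarrow> ('v \<times> 'f) set set) \<Rightarrow> bool" where
  "signable_assignment G L C \<longleftrightarrow> (\<forall>e\<in>medges G. signable_matching_on G L e (C e))"

definition sign_function ::
    "('v, 'e) multigraph \<Rightarrow> ('e \<Rightarrow> ('v \<times> 'f::field) set set) \<Rightarrow> ('e \<Rightarrow> int) \<Rightarrow> bool" where
  "sign_function G C \<sigma> \<longleftrightarrow>
     (\<forall>e\<in>medges G. \<forall>v w. mends G e = {v, w} \<longrightarrow> admissible_sign v w (C e) (\<sigma> e))"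

text \<open>
  If some \<open>L v\<close> is infinite, the set of admissible \<open>k\<close> may be empty, in which case the value of
  \<open>LEAST\<close> is unspecified.
\<close>

definition omega_s ::
    "('v, 'e) multigraph \<Rightarrow> ('v \<Rightarrow> 'f::field set) \<Rightarrow> ('e \<Rightarrow> ('v \<times> 'f) set set) \<Rightarrow> 'e \<Rightarrow> nat" where
  "omega_s G L C e =
     (LEAST k. \<exists>M. (\<forall>i\<in>{1..k}. signable_matching_on G L e (M i)) \<and> C e = (\<Union>i\<in>{1..k}. M i))"

definition signed_multigraph ::
    "('v, 'e) multigraph \<Rightarrow> ('v \<Rightarrow> 'f::field set) \<Rightarrow> ('e \<Rightarrow> ('v \<times> 'f) set set) \<Rightarrow>
     ('v, 'e \<times> nat) multigraph" where
  "signed_multigraph G L C =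
     \<lparr> mverts = mverts G,
       medges = (SIGMA e : medges G. {1..omega_s G L C e}),
       mends = (\<lambda>(e, i). mends G e) \<rparr>"

section \<open>The field\<close>

text \<open>
  The canonical ring homomorphism from the integers is onto with kernel generated by \<open>p\<close>,
  i.e. it induces an isomorphism from the integers modulo \<open>p\<close> to the field.
\<close>

definition is_Z_mod :: "'f::field itself \<Rightarrow> nat \<Rightarrow> bool" where
  "is_Z_mod F p \<longleftrightarrow> surj (of_int :: int \<Rightarrow> 'f) \<and> (\<forall>n. (of_int n :: 'f) = 0 \<longleftrightarrow> int p dvd n)"

definition zero_in_field :: "'f::field itself \<Rightarrow> int \<Rightarrow> bool" where
  "zero_in_field F n \<longleftrightarrow> (if CHAR('f) = 0 then n = 0 else [n = 0] (mod int CHAR('f)))"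

end

theory Submission
  imports Defs "HOL-Library.FuncSet"
begin

text \<open>
  A colouring is a point \<open>x\<close> of \<open>\<Prod>v. L v\<close> at which the product over the arcs \<open>e = (v, w)\<close>
  of \<open>x v - \<sigma> e * x w - a e\<close> does not vanish. On a set of \<open>d + 1\<close> field elements there are weights
  whose pairing with \<open>c ^ k\<close> is \<open>1\<close> for \<open>k = d\<close> and \<open>0\<close> for \<open>k < d\<close>. Summing the product against the
  product of such weights over a grid extracts the coefficient of \<open>\<Prod>v. x v ^ d v\<close>, as in the
  Combinatorial Nullstellensatz. If \<open>d\<close> is the out-degree, the contributing choices of one endpoint
  per arc are those in which the arcs represented by their heads form an Eulerian subdigraph,
  so the coefficient is the difference of the numbers of even and odd ones in the auxiliary digraph.
\<close>

section \<open>Nonvanishing of products of affine forms\<close>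

text \<open>The weights are those of the divided difference, \<open>1 / (c - c')\<close> multiplied
  over all other points \<open>c'\<close>. They are built by induction: dividing old weights by
  \<open>c - b\<close> raises the order by one, and the weight at the new point \<open>b\<close>
  cancels the zeroth moment.\<close>

lemma moment_weights_exist:
  fixes S :: "'f::field set"
  assumes "finite S" "card S = Suc d"
  shows "\<exists>w. \<forall>k\<le>d. (\<Sum>c\<in>S. w c * c ^ k) = (if k = d then 1 else 0)"
  using assms
proof (induction S arbitrary: d rule: finite_induct)
  case empty
  then show ?case by simp
next
  case (insert b S)
  show ?case
  proof (cases d)
    case 0
    with insert have "S = {}" by simp
    with 0 show ?thesis by (intro exI[of _ "\<lambda>_. 1"]) simp
  next
    case (Suc d')
    with insert have "card S = Suc d'" by simp
    from insert.IH[OF this] obtain w where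
      w: "\<And>k. k \<le> d' \<Longrightarrow> (\<Sum>c\<in>S. w c * c ^ k) = (if k = d' then 1 else 0)" by blast
    define u where "u = (\<lambda>c. w c / (c - b))"
    define w' where "w' = u(b := - sum u S)"
    define M where "M = (\<lambda>k. \<Sum>c\<in>insert b S. w' c * c ^ k)"
    have M: "M k = (\<Sum>c\<in>S. u c * c ^ k) - sum u S * b ^ k" for k
    proof -
      have "(\<Sum>c\<in>S. w' c * c ^ k) = (\<Sum>c\<in>S. u c * c ^ k)"
        using insert.hyps by (intro sum.cong) (auto simp: w'_def)
      then show ?thesis using insert.hyps by (simp add: M_def w'_def)
    qed
    \<comment> \<open>Multiplying by \<open>c - b\<close> undoes the division and kills the term at
      \<open>b\<close>. Starting from \<open>M 0 = 0\<close>, the recurrence therefore stays at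
      \<open>0\<close> until the old moment of order \<open>d'\<close> contributes the
      \<open>1\<close> at order \<open>d = Suc d'\<close>.\<close>
    have step: "M (Suc k) = b * M k + (\<Sum>c\<in>S. w c * c ^ k)" for k
    proof -
      have "(\<Sum>c\<in>S. w c * c ^ k) = (\<Sum>c\<in>S. u c * c ^ Suc k - b * (u c * c ^ k))"
      proof (intro sum.cong refl)
        fix c assume "c \<in> S"
        with insert.hyps have "c - b \<noteq> 0" by auto
        then have "w c = u c * (c - b)" by (simp add: u_def)
        then show "w c * c ^ k = u c * c ^ Suc k - b * (u c * c ^ k)"
          by (simp only:) (simp add: algebra_simps)
      qed
      then show ?thesis by (simp add: M sum_subtractf sum_distrib_left algebra_simps)
    qed
    have "M k = (if k = d then 1 else 0)" if "k \<le> d" for k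
      using that
    proof (induction k)
      case 0
      then show ?case by (simp add: M Suc)
    next
      case (Suc k)
      then show ?case using \<open>d = Suc d'\<close> by (simp add: step w)
    qed
    then show ?thesis unfolding M_def by blast
  qed
qed

text \<open>The sum in \<open>nz\<close> is the coefficient of the monomial with exponents
  \<open>d\<close> in the product of the forms. Since \<open>d\<close> sums to
  \<open>card E\<close>, this monomial has top degree, so the constants \<open>a e\<close> cannot
  contribute to it.\<close>

lemma prod_affine_forms_nonvanishing:
  fixes a :: "'e \<Rightarrow> 'f::field" and l :: "'e \<Rightarrow> 'v \<Rightarrow> 'f"
  assumes "finite V" "finite E"
    and N: "\<And>e. e \<in> E \<Longrightarrow> N e \<subseteq> V"
    and S: "\<And>v. v \<in> V \<Longrightarrow> card (S v) = Suc (d v)"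
    and d: "sum d V = card E"
    and nz: "(\<Sum>\<chi>\<in>{\<chi> \<in> PiE E N. \<forall>v\<in>V. card {e \<in> E. \<chi> e = v} = d v}. \<Prod>e\<in>E. l e (\<chi> e)) \<noteq> 0"
  shows "\<exists>x\<in>PiE V S. \<forall>e\<in>E. a e + (\<Sum>v\<in>N e. l e v * x v) \<noteq> 0"
proof (rule ccontr)
  assume "\<not> ?thesis"
  then have zero: "(\<Prod>e\<in>E. a e + (\<Sum>v\<in>N e. l e v * x v)) = 0" if "x \<in> PiE V S" for x
    using that \<open>finite E\<close> by auto
  \<comment> \<open>An infinite set has \<open>card\<close> equal to \<open>0\<close>, so a
    successor cardinality forces finiteness.\<close>
  have finS: "finite (S v)" if "v \<in> V" for v
    using S[OF that] by (metis card.infinite nat.distinct(1))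
  have finN: "finite (N e)" if "e \<in> E" for e
    using N[OF that] \<open>finite V\<close> finite_subset by blast
  have "\<forall>v\<in>V. \<exists>w. \<forall>k\<le>d v. (\<Sum>c\<in>S v. w c * c ^ k) = (if k = d v then 1 else 0)"
    using moment_weights_exist finS S by blast
  then obtain w where
    w: "\<And>v k. v \<in> V \<Longrightarrow> k \<le> d v \<Longrightarrow> (\<Sum>c\<in>S v. w v c * c ^ k) = (if k = d v then 1 else 0)"
    by metis
  \<comment> \<open>The choice \<open>None\<close> stands for the constant term of an affine form.\<close>
  define O' where "O' = (\<lambda>e. insert None (Some ` N e))"
  define coef where "coef = (\<lambda>e. case_option (a e) (l e))"
  define mon :: "('v \<Rightarrow> 'f) \<Rightarrow> 'v option \<Rightarrow> 'f" where "mon = (\<lambda>x. case_option 1 x)"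
  \<comment> \<open>This is the exponent of \<open>x v\<close> in the monomial that
    \<open>\<chi>\<close> picks when the product is expanded.\<close>
  define \<kappa> :: "('e \<Rightarrow> 'v option) \<Rightarrow> 'v \<Rightarrow> nat"
    where "\<kappa> = (\<lambda>\<chi> v. card {e \<in> E. \<chi> e = Some v})"
  define good where "good = {\<chi> \<in> PiE E O'. \<forall>v\<in>V. \<kappa> \<chi> v = d v}"
  have finO: "finite (O' e)" if "e \<in> E" for e
    using finN[OF that] by (simp add: O'_def)
  have fib: "{e \<in> E. \<chi> e \<noteq> None} = (\<Union>v\<in>V. {e \<in> E. \<chi> e = Some v})" if "\<chi> \<in> PiE E O'" for \<chi>
    using that N by (fastforce simp: O'_def PiE_iff)
  have mon_prod: "(\<Prod>e\<in>E. mon x (\<chi> e)) = (\<Prod>v\<in>V. x v ^ \<kappa> \<chi> v)" if "\<chi> \<in> PiE E O'" for \<chi> x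
  proof -
    have "(\<Prod>e\<in>E. mon x (\<chi> e)) = (\<Prod>e\<in>{e \<in> E. \<chi> e \<noteq> None}. mon x (\<chi> e))"
      using \<open>finite E\<close> by (intro prod.mono_neutral_right) (auto simp: mon_def)
    also have "\<dots> = (\<Prod>v\<in>V. \<Prod>e\<in>{e \<in> E. \<chi> e = Some v}. mon x (\<chi> e))"
      unfolding fib[OF that] using \<open>finite E\<close> \<open>finite V\<close> by (intro prod.UNION_disjoint) auto
    also have "\<dots> = (\<Prod>v\<in>V. x v ^ \<kappa> \<chi> v)"
      by (intro prod.cong refl) (simp add: mon_def \<kappa>_def)
    finally show ?thesis .
  qed
  have sum_\<kappa>: "(\<Sum>v\<in>V. \<kappa> \<chi> v) = card {e \<in> E. \<chi> e \<noteq> None}" if "\<chi> \<in> PiE E O'" for \<chi>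
    unfolding fib[OF that] \<kappa>_def using \<open>finite E\<close> \<open>finite V\<close>
    by (intro card_UN_disjoint[symmetric]) auto
  \<comment> \<open>The weights say nothing about exponents above \<open>d v\<close>. But the
    exponents of \<open>\<chi>\<close> sum to at most \<open>card E\<close>, the sum of
    \<open>d\<close>, so a choice that is not good has some exponent below \<open>d v\<close>, and
    the factor at that vertex is zero.\<close>
  have val: "(\<Prod>v\<in>V. \<Sum>c\<in>S v. w v c * c ^ \<kappa> \<chi> v) = (if \<chi> \<in> good then 1 else 0)"
    if "\<chi> \<in> PiE E O'" for \<chi>
  proof (cases "\<chi> \<in> good")
    case True
    then show ?thesis by (simp add: good_def w)
  next
    case False
    have "\<exists>v\<in>V. \<kappa> \<chi> v < d v"
    proof (rule ccontr)
      assume "\<not> ?thesis"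
      then have ge: "\<And>v. v \<in> V \<Longrightarrow> d v \<le> \<kappa> \<chi> v" by force
      have "sum (\<kappa> \<chi>) V \<le> sum d V"
        unfolding sum_\<kappa>[OF that] d using \<open>finite E\<close> by (intro card_mono) auto
      then have "sum (\<kappa> \<chi>) V = sum d V"
        using sum_mono[OF ge, of V] by (simp add: le_antisym)
      then have "\<forall>v\<in>V. \<kappa> \<chi> v = d v"
        using sum_mono_inv[of d V "\<kappa> \<chi>"] ge \<open>finite V\<close> by metis
      with False that show False by (simp add: good_def)
    qed
    then obtain v where "v \<in> V" "\<kappa> \<chi> v < d v" by blast
    then have "(\<Sum>c\<in>S v. w v c * c ^ \<kappa> \<chi> v) = 0" by (simp add: w)
    with \<open>v \<in> V\<close> False \<open>finite V\<close> show ?thesis by (auto intro!: bexI[of _ v])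
  qed
  \<comment> \<open>The weighted grid sum is zero because the product vanishes on the whole grid;
    expanding it into monomials and factoring each grid sum over the vertices turns it into the
    coefficient.\<close>
  have "0 = (\<Sum>x\<in>PiE V S. (\<Prod>v\<in>V. w v (x v)) * (\<Prod>e\<in>E. a e + (\<Sum>v\<in>N e. l e v * x v)))"
    using zero by simp
  also have "\<dots> = (\<Sum>x\<in>PiE V S. \<Sum>\<chi>\<in>PiE E O'.
      (\<Prod>e\<in>E. coef e (\<chi> e)) * (\<Prod>v\<in>V. w v (x v) * x v ^ \<kappa> \<chi> v))"
  proof (intro sum.cong refl)
    fix x
    have "(\<Prod>e\<in>E. a e + (\<Sum>v\<in>N e. l e v * x v)) = (\<Prod>e\<in>E. \<Sum>y\<in>O' e. coef e y * mon x y)"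
    proof (intro prod.cong refl)
      fix e assume "e \<in> E"
      then show "a e + (\<Sum>v\<in>N e. l e v * x v) = (\<Sum>y\<in>O' e. coef e y * mon x y)"
        unfolding O'_def using finN
        by (subst sum.insert) (auto simp: coef_def mon_def sum.reindex)
    qed
    also have "\<dots> = (\<Sum>\<chi>\<in>PiE E O'. \<Prod>e\<in>E. coef e (\<chi> e) * mon x (\<chi> e))"
      using \<open>finite E\<close> finO by (rule prod_sum_PiE)
    also have "\<dots> = (\<Sum>\<chi>\<in>PiE E O'. (\<Prod>e\<in>E. coef e (\<chi> e)) * (\<Prod>v\<in>V. x v ^ \<kappa> \<chi> v))"
      by (intro sum.cong refl) (simp add: prod.distrib mon_prod)
    finally show "(\<Prod>v\<in>V. w v (x v)) * (\<Prod>e\<in>E. a e + (\<Sum>v\<in>N e. l e v * x v)) =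
      (\<Sum>\<chi>\<in>PiE E O'. (\<Prod>e\<in>E. coef e (\<chi> e)) * (\<Prod>v\<in>V. w v (x v) * x v ^ \<kappa> \<chi> v))"
      by (simp add: prod.distrib sum_distrib_left mult.left_commute)
  qed
  also have "\<dots> = (\<Sum>\<chi>\<in>PiE E O'. (\<Prod>e\<in>E. coef e (\<chi> e)) *
      (\<Sum>x\<in>PiE V S. \<Prod>v\<in>V. w v (x v) * x v ^ \<kappa> \<chi> v))"
    by (subst sum.swap) (simp add: sum_distrib_left)
  also have "\<dots> = (\<Sum>\<chi>\<in>PiE E O'. (\<Prod>e\<in>E. coef e (\<chi> e)) *
      (\<Prod>v\<in>V. \<Sum>c\<in>S v. w v c * c ^ \<kappa> \<chi> v))"
    using \<open>finite V\<close> finS by (simp add: prod_sum_PiE)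
  also have "\<dots> = (\<Sum>\<chi>\<in>PiE E O'. if \<chi> \<in> good then (\<Prod>e\<in>E. coef e (\<chi> e)) else 0)"
    by (intro sum.cong refl) (simp add: val)
  also have "\<dots> = (\<Sum>\<chi>\<in>good. \<Prod>e\<in>E. coef e (\<chi> e))"
    using \<open>finite E\<close> finO
    by (subst sum.inter_restrict[symmetric]) (auto simp: good_def intro!: finite_PiE sum.cong)
  \<comment> \<open>The exponents of a good choice sum to \<open>card E\<close>, so it never picks
    \<open>None\<close>, and removing the constructor \<open>Some\<close> is a bijection.\<close>
  also have "\<dots> = (\<Sum>\<chi>\<in>{\<chi> \<in> PiE E N. \<forall>v\<in>V. card {e \<in> E. \<chi> e = v} = d v}. \<Prod>e\<in>E. l e (\<chi> e))"
  proof (rule sum.reindex_bij_witness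
      [where i = "\<lambda>\<chi>. \<lambda>e\<in>E. Some (\<chi> e)" and j = "\<lambda>\<chi>. \<lambda>e\<in>E. the (\<chi> e)"])
    fix \<chi> assume g: "\<chi> \<in> good"
    then have P: "\<chi> \<in> PiE E O'" and k: "\<And>v. v \<in> V \<Longrightarrow> \<kappa> \<chi> v = d v" by (auto simp: good_def)
    have "card {e \<in> E. \<chi> e \<noteq> None} = card E"
      using sum_\<kappa>[OF P] k d by simp
    then have "{e \<in> E. \<chi> e \<noteq> None} = E"
      using \<open>finite E\<close> by (intro card_subset_eq) auto
    then have "\<chi> e \<noteq> None" if "e \<in> E" for e
      using that by blast
    then have some: "Some (the (\<chi> e)) = \<chi> e" if "e \<in> E" for e
      using that by simp
    show "(\<lambda>e\<in>E. Some ((\<lambda>e\<in>E. the (\<chi> e)) e)) = \<chi>"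
      using P some by (auto simp: fun_eq_iff PiE_iff extensional_def)
    have "{e \<in> E. (\<lambda>e\<in>E. the (\<chi> e)) e = v} = {e \<in> E. \<chi> e = Some v}" for v
      using some by force
    moreover have "(\<lambda>e\<in>E. the (\<chi> e)) \<in> PiE E N"
    proof (intro PiE_I)
      fix e assume "e \<in> E"
      then have "\<chi> e \<in> O' e" using P by auto
      with some[OF \<open>e \<in> E\<close>] \<open>e \<in> E\<close> show "(\<lambda>e\<in>E. the (\<chi> e)) e \<in> N e"
        by (auto simp: O'_def)
    qed auto
    ultimately show "(\<lambda>e\<in>E. the (\<chi> e)) \<in> {\<chi> \<in> PiE E N. \<forall>v\<in>V. card {e \<in> E. \<chi> e = v} = d v}"
      using k by (simp add: \<kappa>_def)
    show "(\<Prod>e\<in>E. l e ((\<lambda>e\<in>E. the (\<chi> e)) e)) = (\<Prod>e\<in>E. coef e (\<chi> e))"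
    proof (intro prod.cong refl)
      fix e assume "e \<in> E"
      then show "l e ((\<lambda>e\<in>E. the (\<chi> e)) e) = coef e (\<chi> e)"
        using some[OF \<open>e \<in> E\<close>] by (auto simp: coef_def split: option.splits)
    qed
  next
    fix \<chi> assume g: "\<chi> \<in> {\<chi> \<in> PiE E N. \<forall>v\<in>V. card {e \<in> E. \<chi> e = v} = d v}"
    then show "(\<lambda>e\<in>E. the ((\<lambda>e\<in>E. Some (\<chi> e)) e)) = \<chi>"
      by (auto simp: fun_eq_iff PiE_iff extensional_def)
    have "{e \<in> E. (\<lambda>e\<in>E. Some (\<chi> e)) e = Some v} = {e \<in> E. \<chi> e = v}" for v
      by auto
    with g show "(\<lambda>e\<in>E. Some (\<chi> e)) \<in> good"
      by (auto simp: good_def \<kappa>_def O'_def PiE_iff)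
  qed
  finally show False using nz by simp
qed

section \<open>Eulerian subdigraphs of the auxiliary digraph\<close>

text \<open>These are the arc sets of the spanning Eulerian subdigraphs of \<open>D\<close> itself,
  before any arc is subdivided.\<close>

definition balanced_arc_sets :: "('v, 'e) pre_digraph \<Rightarrow> 'e set set" where
  "balanced_arc_sets D =
     {A. A \<subseteq> arcs D \<and> (\<forall>v\<in>verts D. card {e \<in> A. tail D e = v} = card {e \<in> A. head D e = v})}"

text \<open>For \<open>A\<close> inside \<open>arcs D\<close>, both halves of a subdivided arc are
  kept or dropped together. All vertices stay, so the midpoint of a dropped arc is isolated.\<close>

definition aux_subdigraph ::
    "('v, 'e) pre_digraph \<Rightarrow> ('e \<Rightarrow> int) \<Rightarrow> 'e set \<Rightarrow> ('v + 'e, 'e + 'e) pre_digraph" where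
  "aux_subdigraph D \<sigma> A =
     (aux_digraph D \<sigma>)\<lparr>arcs := Inl ` A \<union> Inr ` {e \<in> A. \<sigma> e = -1}\<rparr>"

lemma inj_aux_subdigraph: "inj (aux_subdigraph D \<sigma>)"
  by (rule inj_on_inverseI[where g = "\<lambda>H. {e. Inl e \<in> arcs H}"]) (auto simp: aux_subdigraph_def)

text \<open>Midpoints are balanced automatically, with degrees one and one or zero and zero. At an
  original vertex, subdivision changes which arc enters (\<open>Inr e\<close> instead of
  \<open>Inl e\<close>) but not how many.\<close>

lemma eulerian_aux_subdigraph_iff:
  fixes D :: "('v, 'e) pre_digraph"
  assumes "A \<subseteq> arcs D"
  shows "eulerian_digraph (aux_subdigraph D \<sigma> A) \<longleftrightarrow> A \<in> balanced_arc_sets D"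
proof -
  let ?H = "aux_subdigraph D \<sigma> A"
  have "out_arcs ?H (Inl v) = Inl ` {e \<in> A. tail D e = v}" for v
    by (auto simp: out_arcs_def aux_subdigraph_def aux_digraph_def)
  then have out_l: "out_degree ?H (Inl v) = card {e \<in> A. tail D e = v}" for v
    by (simp add: out_degree_def card_image)
  have "in_arcs ?H (Inl v) = (\<lambda>e. if \<sigma> e = -1 then Inr e else Inl e) ` {e \<in> A. head D e = v}" for v
    by (auto simp: in_arcs_def aux_subdigraph_def aux_digraph_def image_iff split: if_splits)
  moreover have "inj (\<lambda>e. if \<sigma> e = -1 then Inr e else Inl e :: 'e + 'e)"
    by (auto simp: inj_def split: if_splits)
  ultimately have in_l: "in_degree ?H (Inl v) = card {e \<in> A. head D e = v}" for v
    by (simp only: in_degree_def) (rule card_image, erule inj_on_subset, simp)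
  have "out_arcs ?H (Inr e) = (if e \<in> A \<and> \<sigma> e = -1 then {Inr e} else {})"
    "in_arcs ?H (Inr e) = (if e \<in> A \<and> \<sigma> e = -1 then {Inl e} else {})" for e
    by (auto simp: out_arcs_def in_arcs_def aux_subdigraph_def aux_digraph_def split: if_splits)
  then have r: "out_degree ?H (Inr e) = in_degree ?H (Inr e)" for e
    by (simp add: out_degree_def in_degree_def)
  have "verts ?H = Inl ` verts D \<union> Inr ` {e \<in> arcs D. \<sigma> e = -1}"
    by (simp add: aux_subdigraph_def aux_digraph_def)
  then show ?thesis
    using assms by (simp add: eulerian_digraph_def balanced_arc_sets_def ball_Un out_l in_l r)
qed

lemma spanning_aux_subdigraph:
  assumes "wf_digraph D" "A \<subseteq> arcs D"
  shows "spanning (aux_subdigraph D \<sigma> A) (aux_digraph D \<sigma>)"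
proof -
  have sub: "arcs (aux_subdigraph D \<sigma> A) \<subseteq> arcs (aux_digraph D \<sigma>)"
    using assms(2) by (auto simp: aux_subdigraph_def aux_digraph_def)
  have wf: "wf_digraph (aux_digraph D \<sigma>)" using assms(1) by (rule wf_aux_digraph)
  with sub have "wf_digraph (aux_subdigraph D \<sigma> A)"
    by (auto simp: wf_digraph_def aux_subdigraph_def)
  with sub wf show ?thesis
    by (simp add: spanning_def subgraph_def compatible_def aux_subdigraph_def)
qed

text \<open>A midpoint has a single possible arc in and a single possible arc out, so balance there
  forces both halves or neither. The subdigraph is thus determined by its arcs of the form
  \<open>Inl e\<close>.\<close>

lemma spanning_eulerian_aux_digraph:
  assumes "wf_digraph D"
  shows "{H. spanning H (aux_digraph D \<sigma>) \<and> eulerian_digraph H} =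
    aux_subdigraph D \<sigma> ` balanced_arc_sets D"
proof (intro equalityI subsetI)
  fix H assume "H \<in> {H. spanning H (aux_digraph D \<sigma>) \<and> eulerian_digraph H}"
  then have sp: "spanning H (aux_digraph D \<sigma>)" and eu: "eulerian_digraph H" by auto
  from sp have V: "verts H = verts (aux_digraph D \<sigma>)"
    and T: "tail H = tail (aux_digraph D \<sigma>)" and Hd: "head H = head (aux_digraph D \<sigma>)"
    and sub: "arcs H \<subseteq> arcs (aux_digraph D \<sigma>)"
    by (auto simp: spanning_def subgraph_def compatible_def)
  define A where "A = {e. Inl e \<in> arcs H}"
  have A: "A \<subseteq> arcs D" using sub by (auto simp: A_def aux_digraph_def)
  have "Inr e \<in> arcs H \<longleftrightarrow> Inl e \<in> arcs H" if e: "e \<in> arcs D" "\<sigma> e = -1" for e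
  proof -
    have "out_arcs H (Inr e) = (if Inr e \<in> arcs H then {Inr e} else {})"
      using sub by (auto simp: out_arcs_def T aux_digraph_def)
    moreover have "in_arcs H (Inr e) = (if Inl e \<in> arcs H then {Inl e} else {})"
      using sub e by (auto simp: in_arcs_def Hd aux_digraph_def split: if_splits)
    moreover have "out_degree H (Inr e) = in_degree H (Inr e)"
      using eu e by (auto simp: eulerian_digraph_def V aux_digraph_def)
    ultimately show ?thesis by (auto simp: out_degree_def in_degree_def split: if_splits)
  qed
  then have "arcs H = Inl ` A \<union> Inr ` {e \<in> A. \<sigma> e = -1}"
    using sub A by (auto simp: A_def aux_digraph_def)
  then have H: "H = aux_subdigraph D \<sigma> A"
    using V T Hd by (simp add: aux_subdigraph_def)
  then show "H \<in> aux_subdigraph D \<sigma> ` balanced_arc_sets D"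
    using eu eulerian_aux_subdigraph_iff[OF A, of \<sigma>] by blast
next
  fix H assume "H \<in> aux_subdigraph D \<sigma> ` balanced_arc_sets D"
  then obtain A where H: "H = aux_subdigraph D \<sigma> A" and A: "A \<in> balanced_arc_sets D" by blast
  then have "A \<subseteq> arcs D" by (simp add: balanced_arc_sets_def)
  with A assms show "H \<in> {H. spanning H (aux_digraph D \<sigma>) \<and> eulerian_digraph H}"
    by (simp add: H spanning_aux_subdigraph eulerian_aux_subdigraph_iff)
qed

text \<open>An arc of sign \<open>1\<close> adds one arc to the subdigraph and one of sign
  \<open>-1\<close> adds two. In both cases the factor contributed to the parity sign is
  \<open>- \<sigma> e\<close>.\<close>

lemma EE_minus_EO_aux_digraph:
  fixes D :: "('v, 'e) pre_digraph"
  assumes "wf_digraph D" "finite (arcs D)" "\<And>e. e \<in> arcs D \<Longrightarrow> \<sigma> e \<in> {1, -1}"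
  shows "int (EE (aux_digraph D \<sigma>)) - int (EO (aux_digraph D \<sigma>)) =
    (\<Sum>A\<in>balanced_arc_sets D. \<Prod>e\<in>A. - \<sigma> e)"
proof -
  let ?B = "balanced_arc_sets D" and ?h = "aux_subdigraph D \<sigma>"
  let ?n = "\<lambda>A. card (arcs (?h A))"
  have finB: "finite ?B"
    using assms(2) by (intro finite_subset[of ?B "Pow (arcs D)"]) (auto simp: balanced_arc_sets_def)
  have sign: "(-1) ^ ?n A = (\<Prod>e\<in>A. - \<sigma> e)" if "A \<in> ?B" for A
  proof -
    have A: "A \<subseteq> arcs D" using that by (simp add: balanced_arc_sets_def)
    then have finA: "finite A" using assms(2) finite_subset by blast
    have "?n A = card (A <+> {e \<in> A. \<sigma> e = -1})"
      by (simp add: aux_subdigraph_def Plus_def)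
    then have "?n A = card A + card {e \<in> A. \<sigma> e = -1}"
      using finA by (simp add: card_Plus)
    moreover have "(\<Prod>e\<in>A. if \<sigma> e = -1 then -1 else 1 :: int) = (-1) ^ card {e \<in> A. \<sigma> e = -1}"
      using finA by (simp add: prod.If_cases Int_def)
    ultimately have "(-1) ^ ?n A = (\<Prod>e\<in>A. (-1) * (if \<sigma> e = -1 then -1 else 1 :: int))"
      by (simp only: prod.distrib) (simp add: power_add)
    also have "\<dots> = (\<Prod>e\<in>A. - \<sigma> e)"
      using A assms(3) by (intro prod.cong) fastforce+
    finally show ?thesis .
  qed
  \<comment> \<open>The predicate \<open>P\<close> stands for either parity, so one transfer along
    the injection serves both \<open>EE\<close> and \<open>EO\<close>.\<close>
  have count: "card {H. spanning H (aux_digraph D \<sigma>) \<and> eulerian_digraph H \<and> P (card (arcs H))} =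
      card {A \<in> ?B. P (?n A)}" for P
  proof -
    have "{H. spanning H (aux_digraph D \<sigma>) \<and> eulerian_digraph H \<and> P (card (arcs H))} =
        {H \<in> ?h ` ?B. P (card (arcs H))}"
      using spanning_eulerian_aux_digraph[OF assms(1), of \<sigma>] by blast
    also have "\<dots> = ?h ` {A \<in> ?B. P (?n A)}" by blast
    finally show ?thesis by (simp add: card_image inj_on_subset[OF inj_aux_subdigraph])
  qed
  have "(\<Sum>A\<in>?B. \<Prod>e\<in>A. - \<sigma> e) = (\<Sum>A\<in>?B. (-1) ^ ?n A)"
    by (simp add: sign)
  also have "\<dots> = (\<Sum>A\<in>?B. if even (?n A) then 1 else -1)"
    by (intro sum.cong refl) (simp add: uminus_power_if)
  also have "\<dots> = int (card {A \<in> ?B. even (?n A)}) - int (card {A \<in> ?B. odd (?n A)})"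
    using finB by (simp add: sum.If_cases Int_def)
  finally show ?thesis unfolding EE_def EO_def count[of even] count[of odd] by simp
qed

text \<open>
  The arcs represented by their heads in an endpoint choice \<open>\<chi>\<close> form a balanced set exactly when
  every vertex is chosen as often as its out-degree.
\<close>

lemma sum_endpoint_choices:
  fixes g :: "'e \<Rightarrow> 'f::comm_ring_1"
  assumes "finite (arcs D)" and loopless: "\<And>e. e \<in> arcs D \<Longrightarrow> tail D e \<noteq> head D e"
  shows "(\<Sum>\<chi>\<in>{\<chi> \<in> (\<Pi>\<^sub>E e\<in>arcs D. {tail D e, head D e}).
        \<forall>v\<in>verts D. card {e \<in> arcs D. \<chi> e = v} = out_degree D v}.
      \<Prod>e\<in>arcs D. if \<chi> e = tail D e then 1 else g e) =
    (\<Sum>A\<in>balanced_arc_sets D. \<Prod>e\<in>A. g e)" (is "sum _ ?X = _")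
proof -
  let ?E = "arcs D"
  \<comment> \<open>The inverse map collects the arcs not represented by their tails; looplessness
    makes \<open>A\<close> recoverable.\<close>
  define ch where "ch = (\<lambda>A. \<lambda>e\<in>?E. if e \<in> A then head D e else tail D e)"
  have ch_eq: "ch A e = tail D e \<longleftrightarrow> e \<notin> A" if "e \<in> ?E" for A e
    using that loopless[OF that] by (simp add: ch_def)
  \<comment> \<open>Both sides of the left equation count the arcs outside \<open>A\<close> with
    tail \<open>v\<close>. Cancelling them leaves the heads in \<open>A\<close> against the tails in
    \<open>A\<close>.\<close>
  have bal: "card {e \<in> ?E. ch A e = v} = out_degree D v \<longleftrightarrow>
      card {e \<in> A. tail D e = v} = card {e \<in> A. head D e = v}" if A: "A \<subseteq> ?E" for A v
  proof -
    have finA: "finite A" using A assms(1) finite_subset by blast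
    have "{e \<in> ?E. ch A e = v} = {e \<in> ?E - A. tail D e = v} \<union> {e \<in> A. head D e = v}"
      using A by (auto simp: ch_def)
    then have "card {e \<in> ?E. ch A e = v} =
        card {e \<in> ?E - A. tail D e = v} + card {e \<in> A. head D e = v}"
      using finA assms(1) by (simp only:) (intro card_Un_disjoint, auto)
    moreover have "out_arcs D v = {e \<in> ?E - A. tail D e = v} \<union> {e \<in> A. tail D e = v}"
      using A by (auto simp: out_arcs_def)
    then have "out_degree D v = card {e \<in> ?E - A. tail D e = v} + card {e \<in> A. tail D e = v}"
      unfolding out_degree_def
      using finA assms(1) by (simp only:) (intro card_Un_disjoint, auto)
    ultimately show ?thesis by auto
  qed
  show ?thesis
  proof (rule sum.reindex_bij_witness[where i = ch and j = "\<lambda>\<chi>. {e \<in> ?E. \<chi> e \<noteq> tail D e}"])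
    fix \<chi> assume x: "\<chi> \<in> ?X"
    let ?A = "{e \<in> ?E. \<chi> e \<noteq> tail D e}"
    show c: "ch ?A = \<chi>"
    proof
      fix e
      show "ch ?A e = \<chi> e"
        using x by (cases "e \<in> ?E") (auto simp: ch_def PiE_iff extensional_def)
    qed
    show "?A \<in> balanced_arc_sets D"
      using x bal[of ?A] unfolding balanced_arc_sets_def c by blast
    have "(\<Prod>e\<in>?E. if \<chi> e = tail D e then 1 else g e) =
        (\<Prod>e\<in>?E. if e \<in> ?A then g e else 1)"
      by (intro prod.cong) auto
    also have "\<dots> = (\<Prod>e\<in>?A. g e)"
      using assms(1) by (subst prod.inter_restrict[symmetric]) (auto intro!: prod.cong)
    finally show "(\<Prod>e\<in>?A. g e) = (\<Prod>e\<in>?E. if \<chi> e = tail D e then 1 else g e)" ..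
  next
    fix A assume A: "A \<in> balanced_arc_sets D"
    then have sub: "A \<subseteq> ?E" by (simp add: balanced_arc_sets_def)
    then show "{e \<in> ?E. ch A e \<noteq> tail D e} = A" using ch_eq by auto
    have "ch A \<in> (\<Pi>\<^sub>E e\<in>?E. {tail D e, head D e})" by (auto simp: ch_def)
    then show "ch A \<in> ?X" using A bal[OF sub] by (simp add: balanced_arc_sets_def)
  qed
qed

text \<open>The counting yields an integer, while the coefficient lives in the field. The kernel of
  the map from the integers is generated by the characteristic, and \<open>0\<close> divides only
  \<open>0\<close>.\<close>

lemma of_int_eq_0_iff_zero_in_field:
  "of_int n = (0 :: 'f::field) \<longleftrightarrow> zero_in_field TYPE('f) n"
  by (simp add: zero_in_field_def of_int_eq_0_iff_char_dvd cong_0_iff)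

section \<open>Colourings from orientations\<close>

text \<open>The exponents are the out-degrees, which sum to the number of arcs because each arc has
  one tail. The coefficient of that monomial is the image in the field of \<open>EE\<close> minus
  \<open>EO\<close> for the auxiliary digraph.\<close>

lemma orientation_nonvanishing:
  fixes D :: "('v, 'e) pre_digraph" and L :: "'v \<Rightarrow> 'f::field set" and a :: "'e \<Rightarrow> 'f"
  assumes "wf_digraph D" "finite (verts D)" "finite (arcs D)"
    and loopless: "\<And>e. e \<in> arcs D \<Longrightarrow> tail D e \<noteq> head D e"
    and \<sigma>: "\<And>e. e \<in> arcs D \<Longrightarrow> \<sigma> e \<in> {1, -1}"
    and nz: "\<not> zero_in_field TYPE('f)
               (int (EE (aux_digraph D \<sigma>)) - int (EO (aux_digraph D \<sigma>)))"
    and L: "\<And>v. v \<in> verts D \<Longrightarrow> finite (L v) \<Longrightarrow> out_degree D v + 1 \<le> card (L v)"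
  shows "\<exists>x. (\<forall>v\<in>verts D. x v \<in> L v) \<and>
    (\<forall>e\<in>arcs D. x (tail D e) - of_int (\<sigma> e) * x (head D e) \<noteq> a e)"
proof -
  let ?V = "verts D" and ?E = "arcs D"
  interpret wf_digraph D by fact
  \<comment> \<open>Lists are trimmed to exactly one element more than the out-degree. Infinite
    lists, whose \<open>card\<close> is \<open>0\<close>, are treated separately.\<close>
  have "\<exists>T. T \<subseteq> L v \<and> card T = Suc (out_degree D v)" if "v \<in> ?V" for v
    using L[OF that] infinite_arbitrarily_large[of "L v"] obtain_subset_with_card_n[of _ "L v"]
    by (metis Suc_eq_plus1)
  then obtain S where
    S: "\<And>v. v \<in> ?V \<Longrightarrow> S v \<subseteq> L v" "\<And>v. v \<in> ?V \<Longrightarrow> card (S v) = Suc (out_degree D v)"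
    by metis
  let ?N = "\<lambda>e. {tail D e, head D e}"
  \<comment> \<open>On the two endpoints this gives the coefficients of
    \<open>x (tail D e) - of_int (\<sigma> e) * x (head D e)\<close>, in the shape required by
    \<open>sum_endpoint_choices\<close>.\<close>
  let ?l = "\<lambda>e v. if v = tail D e then 1 else - of_int (\<sigma> e) :: 'f"
  have "sum (out_degree D) ?V = card (\<Union>v\<in>?V. out_arcs D v)"
    unfolding out_degree_def using assms(2,3)
    by (intro card_UN_disjoint[symmetric]) (auto simp: out_arcs_def)
  also have "(\<Union>v\<in>?V. out_arcs D v) = ?E"
    by (auto simp: out_arcs_def)
  finally have deg: "sum (out_degree D) ?V = card ?E" .
  have "(\<Sum>\<chi>\<in>{\<chi> \<in> PiE ?E ?N. \<forall>v\<in>?V. card {e \<in> ?E. \<chi> e = v} = out_degree D v}.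
      \<Prod>e\<in>?E. ?l e (\<chi> e)) = (\<Sum>A\<in>balanced_arc_sets D. \<Prod>e\<in>A. - of_int (\<sigma> e))"
    using assms(3) loopless by (rule sum_endpoint_choices)
  also have "\<dots> = of_int (\<Sum>A\<in>balanced_arc_sets D. \<Prod>e\<in>A. - \<sigma> e)"
    by simp
  also have "\<dots> = of_int (int (EE (aux_digraph D \<sigma>)) - int (EO (aux_digraph D \<sigma>)))"
    using EE_minus_EO_aux_digraph[of D \<sigma>] assms(1,3) \<sigma> by simp
  also have "\<dots> \<noteq> 0"
    using nz by (simp only: of_int_eq_0_iff_zero_in_field simp_thms)
  finally obtain x where x: "x \<in> PiE ?V S"
    and x': "\<And>e. e \<in> ?E \<Longrightarrow> - a e + (\<Sum>v\<in>?N e. ?l e v * x v) \<noteq> 0"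
    using prod_affine_forms_nonvanishing[of ?V ?E ?N S "out_degree D" ?l "\<lambda>e. - a e"]
      assms(2,3) S(2) deg by auto
  have "x (tail D e) - of_int (\<sigma> e) * x (head D e) \<noteq> a e" if "e \<in> ?E" for e
    using x'[OF that] loopless[OF that] by auto
  moreover have "x v \<in> L v" if "v \<in> ?V" for v
    using x S(1) that by (auto simp: PiE_iff)
  ultimately show ?thesis by blast
qed

theorem corollary29:
  fixes G :: "('v, 'e) multigraph"
    and L :: "'v \<Rightarrow> 'f::field set"
    and C :: "'e \<Rightarrow> ('v \<times> 'f) set set"
    and Cs :: "'e \<times> nat \<Rightarrow> ('v \<times> 'f) set set"
    and \<sigma> :: "'e \<times> nat \<Rightarrow> int"
  assumes "simple_graph G"
    and "CHAR('f) = 0 \<or> (\<exists>p. prime p \<and> is_Z_mod TYPE('f) p)"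
    and "correspondence_assignment G L C"
    and "signable_assignment (signed_multigraph G L C) L Cs"
    and "\<forall>e\<in>medges G. C e = (\<Union>i\<in>{1..omega_s G L C e}. Cs (e, i))"
    and "sign_function (signed_multigraph G L C) Cs \<sigma>"
    and "\<exists>D. is_orientation D (signed_multigraph G L C) \<and>
           \<not> zero_in_field TYPE('f)
               (int (EE (aux_digraph D \<sigma>)) - int (EO (aux_digraph D \<sigma>))) \<and>
           (\<forall>v\<in>mverts G. finite (L v) \<longrightarrow> card (L v) \<ge> out_degree D v + 1)"
  shows "LC_colorable G L C"
proof -
  let ?G = "signed_multigraph G L C"
  from assms(7) obtain D where D: "is_orientation D ?G"
    and nz: "\<not> zero_in_field TYPE('f) (int (EE (aux_digraph D \<sigma>)) - int (EO (aux_digraph D \<sigma>)))"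
    and deg: "\<forall>v\<in>mverts G. finite (L v) \<longrightarrow> card (L v) \<ge> out_degree D v + 1"
    by blast
  have G: "finite (mverts G)" "finite (medges G)"
    "\<And>e. e \<in> medges G \<Longrightarrow> mends G e \<subseteq> mverts G \<and> card (mends G e) = 2"
    using assms(1) by (auto simp: simple_graph_def is_multigraph_def)
  have V: "verts D = mverts G" and E: "arcs D = (SIGMA e : medges G. {1..omega_s G L C e})"
    and ends: "\<And>e i. (e, i) \<in> arcs D \<Longrightarrow> mends G e = {tail D (e, i), head D (e, i)}"
    using D by (auto simp: is_orientation_def signed_multigraph_def)
  have arc: "tail D e \<in> verts D \<and> head D e \<in> verts D \<and> tail D e \<noteq> head D e" if "e \<in> arcs D" for e
  proof -
    obtain f i where "e = (f, i)" by fastforce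
    with that ends[of f i] G(3)[of f] show ?thesis
      unfolding V by (auto simp: E card_2_iff doubleton_eq_iff)
  qed
  have adm: "admissible_sign (tail D e) (head D e) (Cs e) (\<sigma> e)" if "e \<in> arcs D" for e
    using assms(6) D that by (auto simp: sign_function_def is_orientation_def)
  then have "\<forall>e\<in>arcs D. \<exists>a. \<forall>c1 c2.
      {(tail D e, c1), (head D e, c2)} \<in> Cs e \<longrightarrow> c1 - of_int (\<sigma> e) * c2 = a"
    by (auto simp: admissible_sign_def)
  \<comment> \<open>All forbidden pairs of \<open>Cs e\<close> share the one value
    \<open>a e\<close>, so a colouring whose signed difference along \<open>e\<close> avoids
    \<open>a e\<close> avoids the whole matching.\<close>
  then obtain a where a: "\<And>e c1 c2. e \<in> arcs D \<Longrightarrow> {(tail D e, c1), (head D e, c2)} \<in> Cs e \<Longrightarrow>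
      c1 - of_int (\<sigma> e) * c2 = a e"
    by metis
  have "\<exists>x. (\<forall>v\<in>verts D. x v \<in> L v) \<and>
    (\<forall>e\<in>arcs D. x (tail D e) - of_int (\<sigma> e) * x (head D e) \<noteq> a e)"
  proof (rule orientation_nonvanishing)
    show "wf_digraph D" using arc by (simp add: wf_digraph_def)
    show "finite (verts D)" using G V by simp
    show "finite (arcs D)" unfolding E using G by (intro finite_SigmaI) auto
    show "tail D e \<noteq> head D e" if "e \<in> arcs D" for e using arc that by blast
    show "\<sigma> e \<in> {1, -1}" if "e \<in> arcs D" for e using adm[OF that] by (simp add: admissible_sign_def)
    show "out_degree D v + 1 \<le> card (L v)" if "v \<in> verts D" "finite (L v)" for v
      using deg that V by blast
  qed (fact nz)
  then obtain x where xL: "\<And>v. v \<in> mverts G \<Longrightarrow> x v \<in> L v"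
    and xa: "\<And>e. e \<in> arcs D \<Longrightarrow> x (tail D e) - of_int (\<sigma> e) * x (head D e) \<noteq> a e"
    unfolding V by blast
  have "{(u, x u), (v, x v)} \<notin> C e" if "e \<in> medges G" "mends G e = {u, v}" for e u v
  proof
    assume "{(u, x u), (v, x v)} \<in> C e"
    then have "{(u, x u), (v, x v)} \<in> (\<Union>i\<in>{1..omega_s G L C e}. Cs (e, i))"
      by (simp only: bspec[OF assms(5) that(1), symmetric])
    then obtain i where i: "i \<in> {1..omega_s G L C e}" "{(u, x u), (v, x v)} \<in> Cs (e, i)"
      by (rule UN_E)
    let ?t = "tail D (e, i)" and ?h = "head D (e, i)"
    have arc': "(e, i) \<in> arcs D" using E i that by simp
    \<comment> \<open>The pair \<open>u, v\<close> may list the endpoints in either order; comparing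
      images of the unordered endpoint sets avoids a case distinction.\<close>
    have "(\<lambda>w. (w, x w)) ` {u, v} = (\<lambda>w. (w, x w)) ` {?t, ?h}"
      using ends[OF arc'] that(2) by (simp only:)
    then have "{(?t, x ?t), (?h, x ?h)} \<in> Cs (e, i)"
      using i(2) by (simp only: image_insert image_empty)
    then show False using a[OF arc'] xa[OF arc'] by blast
  qed
  with xL have "LC_coloring G L C x" by (auto simp: LC_coloring_def)
  then show ?thesis by (auto simp: LC_colorable_def)
qed

end
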